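(* Let $G$ be a simple graph with at least one edge and with average degree $\bar d$. Let $G^\sigma$ be an oriented graph of $G$ with skew spectral radius $\rho_s(G^\sigma)$ and oriented chromatic number $\chi_o(G^\sigma)$. Then $$\rho_s(G^\sigma)\geq\frac{\bar d}{\chi_o(G^\sigma)-1}.$$
   Context: An oriented graph $G^\sigma$ of a simple graph $G$ on vertices $v_1,\dots,v_n$ is obtained by giving each edge of $G$ one of its two directions. Its skew adjacency matrix $S(G^\sigma)=(s_{ij})$ has $s_{ij}=1$, $s_{ji}=-1$ if $\langle v_i,v_j\rangle$ is an arc, and $s_{ij}=s_{ji}=0$ otherwise. The skew spectral radius $\rho_s(G^\sigma)$ is the spectral radius of $S(G^\sigma)$. The average degree of $G$ with $n$ vertices and $m$ edges is $\bar d=2m/n$. An oriented $k$-coloring of $G^\sigma$ is a partition of the vertex set into $k$ classes such that no two adjacent vertices lie in the same class and, for any two classes, all arcs between them have the same direction (all go from the first class to the second, or all from the second to the first). The oriented chromatic number $\chi_o(G^\sigma)$ is the least $k$ for which an oriented $k$-coloring exists. *)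

theory Defs
  imports
    "HOL-Library.Disjoint_Sets"
    "Graph_Theory.Pair_Digraph"
    "Jordan_Normal_Form.Spectral_Radius"
begin

text \<open>
  A finite simple graph is a \<open>pair_graph\<close>, i.e. a loop-free symmetric digraph in which an edge
  between \<open>u\<close> and \<open>v\<close> is represented by the two pairs \<open>(u, v)\<close> and \<open>(v, u)\<close>.
  An oriented graph is represented by its set of arcs; \<open>(u, v)\<close> is the arc from \<open>u\<close> to \<open>v\<close>.
\<close>

definition edge_set :: "'a pair_pre_digraph \<Rightarrow> 'a set set" where
  "edge_set G = {{u, v} | u v. (u, v) \<in> parcs G}"

definition average_degree :: "'a pair_pre_digraph \<Rightarrow> real" where
  "average_degree G = 2 * real (card (edge_set G)) / real (card (pverts G))"

definition oriented_graph_of :: "'a pair_pre_digraph \<Rightarrow> 'a pair_pre_digraph \<Rightarrow> bool" where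
  "oriented_graph_of G D \<longleftrightarrow>
     pverts D = pverts G \<and>
     parcs D \<union> (parcs D)\<inverse> = parcs G \<and>
     parcs D \<inter> (parcs D)\<inverse> = {}"

text \<open>
  The function \<open>\<nu>\<close> enumerates the vertices as \<open>\<nu> 0, \<dots>, \<nu> (n - 1)\<close>. The entries
  are taken in the complex numbers because the spectral radius refers to complex eigenvalues.
\<close>

definition skew_adjacency_mat :: "'a pair_pre_digraph \<Rightarrow> (nat \<Rightarrow> 'a) \<Rightarrow> complex mat" where
  "skew_adjacency_mat D \<nu> =
     mat (card (pverts D)) (card (pverts D))
       (\<lambda>(i, j). if (\<nu> i, \<nu> j) \<in> parcs D then 1
                 else if (\<nu> j, \<nu> i) \<in> parcs D then -1
                 else 0)"

definition skew_spectral_radius :: "'a pair_pre_digraph \<Rightarrow> (nat \<Rightarrow> 'a) \<Rightarrow> real" where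
  "skew_spectral_radius D \<nu> = spectral_radius (skew_adjacency_mat D \<nu>)"

definition oriented_coloring :: "'a pair_pre_digraph \<Rightarrow> nat \<Rightarrow> 'a set set \<Rightarrow> bool" where
  "oriented_coloring D k P \<longleftrightarrow>
     partition_on (pverts D) P \<and> finite P \<and> card P = k \<and>
     (\<forall>C\<in>P. \<forall>u\<in>C. \<forall>v\<in>C. (u, v) \<notin> parcs D) \<and>
     (\<forall>A\<in>P. \<forall>B\<in>P. A \<noteq> B \<longrightarrow> parcs D \<inter> (A \<times> B) = {} \<or> parcs D \<inter> (B \<times> A) = {})"

definition oriented_chromatic_number :: "'a pair_pre_digraph \<Rightarrow> nat" where
  "oriented_chromatic_number D = (LEAST k. \<exists>P. oriented_coloring D k P)"

end

theory Submission
  imports Defs "HOL-Analysis.L2_Norm"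
begin

text \<open>
  The skew adjacency matrix \<open>S\<close> is normal, so its operator norm is \<open>\<rho>\<^sub>s\<close>. For two colour classes
  \<open>A\<close>, \<open>B\<close> with indicator vectors \<open>a\<close>, \<open>b\<close>, all arcs between them point the same way, so no
  cancellation occurs in \<open>a \<bullet> S b\<close> and the number of arcs between \<open>A\<close> and \<open>B\<close> is
  \<open>\<bar>a \<bullet> S b\<bar> \<le> \<rho>\<^sub>s \<surd>(\<bar>A\<bar> \<bar>B\<bar>) \<le> \<rho>\<^sub>s (\<bar>A\<bar> + \<bar>B\<bar>) / 2\<close>. Summing over all pairs of classes, each class
  occurs \<open>\<chi>\<^sub>o - 1\<close> times, which gives \<open>m \<le> \<rho>\<^sub>s (\<chi>\<^sub>o - 1) n / 2\<close>.
\<close>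

section \<open>The operator norm of a normal real matrix\<close>

definition vnorm :: "real vec \<Rightarrow> real" where
  "vnorm v = sqrt (v \<bullet> v)"

lemma vnorm_eq_L2_set: "vnorm v = L2_set (vec_index v) {0..<dim_vec v}"
  by (simp add: vnorm_def L2_set_def scalar_prod_def power2_eq_square)

lemma vnorm_nonneg [simp]: "0 \<le> vnorm v"
  by (simp add: vnorm_eq_L2_set)

lemma vnorm_sq: "(vnorm v)\<^sup>2 = v \<bullet> v"
  by (simp add: vnorm_def scalar_prod_def sum_nonneg)

lemma abs_scalar_prod_le_vnorm:
  assumes "v \<in> carrier_vec n" "w \<in> carrier_vec n"
  shows "\<bar>v \<bullet> w\<bar> \<le> vnorm v * vnorm w"
proof -
  have "\<bar>v \<bullet> w\<bar> \<le> (\<Sum>i\<in>{0..<n}. \<bar>v $ i\<bar> * \<bar>w $ i\<bar>)"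
    using assms by (auto simp: scalar_prod_def abs_mult[symmetric])
  also have "\<dots> \<le> vnorm v * vnorm w"
    using L2_set_mult_ineq[of "vec_index v" "vec_index w" "{0..<n}"] assms
    by (simp add: vnorm_eq_L2_set)
  finally show ?thesis .
qed

lemma vnorm_smult: "vnorm (c \<cdot>\<^sub>v v) = \<bar>c\<bar> * vnorm v"
proof -
  have "(c \<cdot>\<^sub>v v) \<bullet> (c \<cdot>\<^sub>v v) = c\<^sup>2 * (v \<bullet> v)"
    by (simp add: scalar_prod_def sum_distrib_left power2_eq_square algebra_simps)
  then show ?thesis
    by (simp add: vnorm_def real_sqrt_mult)
qed

text \<open>Normality gives \<open>R\<close> and its transpose the same norm on every vector. Moving
  one \<open>R\<close> across the scalar product \<open>?w \<bullet> ?w\<close> and applying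
  Cauchy-Schwarz to \<open>v\<close> and \<open>?T *\<^sub>v ?w\<close> then yields the
  bound.\<close>

lemma vnorm_normal_log_convex:
  fixes R :: "real mat"
  assumes R: "R \<in> carrier_mat n n"
    and normal: "transpose_mat R * R = R * transpose_mat R"
    and v: "v \<in> carrier_vec n"
  shows "(vnorm (R *\<^sub>v v))\<^sup>2 \<le> vnorm v * vnorm (R *\<^sub>v (R *\<^sub>v v))"
proof -
  let ?T = "transpose_mat R" and ?w = "R *\<^sub>v v"
  have T: "?T \<in> carrier_mat n n" and w: "?w \<in> carrier_vec n"
    and Rw: "R *\<^sub>v ?w \<in> carrier_vec n" and Tw: "?T *\<^sub>v ?w \<in> carrier_vec n"
    using R v by auto
  have "(vnorm (?T *\<^sub>v ?w))\<^sup>2 = ?w \<bullet> (R *\<^sub>v (?T *\<^sub>v ?w))"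
    using transpose_vec_mult_scalar[OF R Tw w] by (simp add: vnorm_sq)
  also have "R *\<^sub>v (?T *\<^sub>v ?w) = ?T *\<^sub>v (R *\<^sub>v ?w)"
    using assoc_mult_mat_vec[OF R T w] assoc_mult_mat_vec[OF T R w] normal by simp
  also have "?w \<bullet> (?T *\<^sub>v (R *\<^sub>v ?w)) = (vnorm (R *\<^sub>v ?w))\<^sup>2"
    using transpose_vec_mult_scalar[OF R w Rw] comm_scalar_prod[of ?w n "?T *\<^sub>v (R *\<^sub>v ?w)"] T Rw w
    by (simp add: vnorm_sq)
  finally have eq: "vnorm (?T *\<^sub>v ?w) = vnorm (R *\<^sub>v ?w)"
    by simp
  have "(vnorm ?w)\<^sup>2 = v \<bullet> (?T *\<^sub>v ?w)"
    using transpose_vec_mult_scalar[OF R v w] comm_scalar_prod[OF v Tw]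
    by (simp add: vnorm_sq)
  also have "\<dots> \<le> vnorm v * vnorm (?T *\<^sub>v ?w)"
    using abs_scalar_prod_le_vnorm[OF v Tw] by linarith
  finally show ?thesis
    using eq by simp
qed

text \<open>Log-convexity keeps the stretch factors along the orbit of \<open>v\<close> from
  decreasing, so a first factor of at least \<open>t\<close> persists at every step.\<close>

lemma vnorm_normal_pow_ge:
  fixes R :: "real mat"
  assumes R: "R \<in> carrier_mat n n"
    and normal: "transpose_mat R * R = R * transpose_mat R"
    and v: "v \<in> carrier_vec n"
    and t: "0 \<le> t" "0 < vnorm v" "t * vnorm v \<le> vnorm (R *\<^sub>v v)"
  shows "t ^ k * vnorm v \<le> vnorm ((R ^\<^sub>m k) *\<^sub>v v)"
  using v t
proof (induction k arbitrary: v)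
  case 0
  then show ?case using R by simp
next
  case (Suc k)
  let ?w = "R *\<^sub>v v"
  have pow: "R ^\<^sub>m k \<in> carrier_mat n n" and w: "?w \<in> carrier_vec n"
    using R Suc.prems by auto
  \<comment> \<open>The extra factor is applied to the vector first, so the induction hypothesis is
    needed at \<open>?w\<close>; hence \<open>v\<close> is generalised.\<close>
  have eq: "(R ^\<^sub>m Suc k) *\<^sub>v v = (R ^\<^sub>m k) *\<^sub>v ?w"
    using assoc_mult_mat_vec[OF pow R Suc.prems(1)] by simp
  show ?case
  proof (cases "t = 0")
    case False
    then have pos: "0 < vnorm ?w"
      using Suc.prems by (metis less_le mult_pos_pos order_less_le_trans)
    \<comment> \<open>The factor \<open>t\<close> passes from \<open>v\<close> to \<open>?w\<close>:
      log-convexity supplies the second inequality, and the positive \<open>vnorm v\<close>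
      cancels.\<close>
    have "vnorm v * (t * vnorm ?w) \<le> vnorm ?w * vnorm ?w"
      using Suc.prems(4) mult_right_mono[OF Suc.prems(4), of "vnorm ?w"] by (simp add: algebra_simps)
    also have "\<dots> \<le> vnorm v * vnorm (R *\<^sub>v ?w)"
      using vnorm_normal_log_convex[OF R normal Suc.prems(1)] by (simp add: power2_eq_square)
    finally have "t * vnorm ?w \<le> vnorm (R *\<^sub>v ?w)"
      using Suc.prems(3) by simp
    from Suc.IH[OF w Suc.prems(2) pos this]
    have "t ^ k * vnorm ?w \<le> vnorm ((R ^\<^sub>m Suc k) *\<^sub>v v)"
      by (simp only: eq)
    moreover have "t ^ Suc k * vnorm v \<le> t ^ k * vnorm ?w"
      using mult_left_mono[OF Suc.prems(4), of "t ^ k"] Suc.prems(2) by (simp add: algebra_simps)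
    ultimately show ?thesis by linarith
  qed simp
qed

text \<open>The Euclidean norm is at most the sum of absolute values, so a crude entrywise estimate
  suffices. The bound depends on \<open>A\<close> only through \<open>c\<close>, hence is uniform
  over powers with a common entry bound.\<close>

lemma vnorm_mult_mat_vec_le:
  fixes A :: "real mat"
  assumes A: "A \<in> carrier_mat n n" and v: "v \<in> carrier_vec n"
    and bound: "\<And>i j. i < n \<Longrightarrow> j < n \<Longrightarrow> \<bar>A $$ (i, j)\<bar> \<le> c"
  shows "vnorm (A *\<^sub>v v) \<le> real n * (c * (\<Sum>j<n. \<bar>v $ j\<bar>))"
proof -
  have entry: "\<bar>(A *\<^sub>v v) $ i\<bar> \<le> c * (\<Sum>j<n. \<bar>v $ j\<bar>)" if i: "i < n" for i
  proof -
    have "\<bar>(A *\<^sub>v v) $ i\<bar> = \<bar>\<Sum>j<n. A $$ (i, j) * v $ j\<bar>"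
      using A v i by (simp add: scalar_prod_def atLeast0LessThan)
    also have "\<dots> \<le> (\<Sum>j<n. \<bar>A $$ (i, j) * v $ j\<bar>)"
      by (rule sum_abs)
    also have "\<dots> \<le> (\<Sum>j<n. c * \<bar>v $ j\<bar>)"
      using bound i by (intro sum_mono) (auto simp: abs_mult intro: mult_right_mono)
    finally show ?thesis by (simp add: sum_distrib_left)
  qed
  have "vnorm (A *\<^sub>v v) \<le> (\<Sum>i\<in>{0..<n}. \<bar>(A *\<^sub>v v) $ i\<bar>)"
    using A L2_set_le_sum_abs[of "vec_index (A *\<^sub>v v)" "{0..<n}"] by (simp add: vnorm_eq_L2_set)
  also have "\<dots> \<le> (\<Sum>i\<in>{0..<n}. c * (\<Sum>j<n. \<bar>v $ j\<bar>))"
    using entry by (intro sum_mono) auto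
  finally show ?thesis by simp
qed

text \<open>
  By log-convexity a normal \<open>R\<close> that stretches \<open>v\<close> by a factor \<open>t > 1\<close> satisfies
  \<open>\<bar>R\<^sup>k v\<bar> \<ge> t\<^sup>k \<bar>v\<bar>\<close>, whereas the powers of a matrix of spectral radius below 1 are bounded.
\<close>

lemma normal_contraction:
  fixes R :: "real mat"
  assumes R: "R \<in> carrier_mat n n"
    and normal: "transpose_mat R * R = R * transpose_mat R"
    and sr: "spectral_radius (map_mat complex_of_real R) < 1"
    and v: "v \<in> carrier_vec n"
  shows "vnorm (R *\<^sub>v v) \<le> vnorm v"
proof (rule ccontr)
  assume "\<not> ?thesis"
  then have gt: "vnorm v < vnorm (R *\<^sub>v v)" by simp
  have "map_mat complex_of_real R \<in> carrier_mat n n" using R by simp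
  \<comment> \<open>A single \<open>c\<close> serves all powers: a spectral radius strictly below 1
    rules out polynomial growth from Jordan blocks.\<close>
  from spectral_radius_jnf_norm_bound_less_1_upper_triangular[OF this sr]
  obtain c where "norm_bound (map_mat complex_of_real R ^\<^sub>m k) c" for k by blast
  then have c: "norm_bound (map_mat complex_of_real (R ^\<^sub>m k)) c" for k
    using of_real_hom.mat_hom_pow[OF R] by metis
  let ?C = "real n * (c * (\<Sum>j<n. \<bar>v $ j\<bar>))"
  have upper: "vnorm ((R ^\<^sub>m k) *\<^sub>v v) \<le> ?C" for k
  proof (rule vnorm_mult_mat_vec_le[OF _ v])
    show pow: "R ^\<^sub>m k \<in> carrier_mat n n" using R by simp
    show "\<bar>(R ^\<^sub>m k) $$ (i, j)\<bar> \<le> c" if "i < n" "j < n" for i j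
      using c[of k] that carrier_matD[OF pow] by (simp add: norm_bound_def del: pow_mat_dim)
  qed
  show False
  proof (cases "vnorm v = 0")
    case True
    then show False
      using vnorm_normal_log_convex[OF R normal v] gt by simp
  next
    case False
    then have pos: "0 < vnorm v" by (simp add: less_le)
    \<comment> \<open>The exact stretch factor of \<open>v\<close>; since it exceeds 1, its powers
      outgrow the fixed bound \<open>?C\<close>.\<close>
    define t where "t = vnorm (R *\<^sub>v v) / vnorm v"
    have "1 < t" using gt pos by (simp add: t_def)
    then obtain k where "?C / vnorm v < t ^ k"
      using real_arch_pow by blast
    then have "?C < t ^ k * vnorm v"
      using pos by (simp add: divide_simps)
    also have "\<dots> \<le> vnorm ((R ^\<^sub>m k) *\<^sub>v v)"
      using \<open>1 < t\<close> pos by (intro vnorm_normal_pow_ge[OF R normal v]) (auto simp: t_def)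
    finally show False using upper[of k] by simp
  qed
qed

text \<open>An eigenvalue \<open>a\<close> of the scaled matrix with largest modulus gives the
  eigenvalue \<open>r * a\<close> of \<open>A\<close>, with the same eigenvector.\<close>

lemma spectral_radius_smult_less_1:
  assumes A: "A \<in> carrier_mat n n" and n: "0 < n"
    and r: "0 < r" "spectral_radius A < r"
  shows "spectral_radius (complex_of_real (1 / r) \<cdot>\<^sub>m A) < 1"
proof -
  let ?c = "complex_of_real (1 / r)"
  have cA: "?c \<cdot>\<^sub>m A \<in> carrier_mat n n" using A by simp
  from spectral_radius_mem_max(1)[OF cA n] obtain a v
    where a: "spectral_radius (?c \<cdot>\<^sub>m A) = norm a"
      and ev: "eigenvector (?c \<cdot>\<^sub>m A) v a"
    by (auto simp: spectrum_def eigenvalue_def)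
  then have v: "v \<in> carrier_vec n" "v \<noteq> 0\<^sub>v n" and eq: "(?c \<cdot>\<^sub>m A) *\<^sub>v v = a \<cdot>\<^sub>v v"
    using A by (auto simp: eigenvector_def)
  have "A *\<^sub>v v = (of_real r * a) \<cdot>\<^sub>v v"
  proof (rule eq_vecI)
    fix i assume "i < dim_vec ((of_real r * a) \<cdot>\<^sub>v v)"
    then have i: "i < n" using v by simp
    have "((?c \<cdot>\<^sub>m A) *\<^sub>v v) $ i = ?c * (A *\<^sub>v v) $ i"
      using A v i by simp
    then have "a * v $ i = ?c * (A *\<^sub>v v) $ i"
      using eq v i by simp
    then show "(A *\<^sub>v v) $ i = ((of_real r * a) \<cdot>\<^sub>v v) $ i"
      using v i r by (simp add: field_simps)
  qed (use A v in auto)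
  then have "of_real r * a \<in> spectrum A"
    using A v by (auto simp: spectrum_def eigenvalue_def eigenvector_def)
  then have "norm (of_real r * a) \<le> spectral_radius A"
    by (intro spectral_radius_mem_max(2)[OF A n] imageI)
  then have "r * norm a < r * 1"
    using r by (simp only: norm_mult norm_of_real)
  then show ?thesis using a r mult_less_cancel_left_pos by metis
qed

text \<open>The contraction bound applies to \<open>R\<close> divided by any
  \<open>r > ?\<rho>\<close>, and \<open>r\<close> then tends to \<open>?\<rho>\<close>. Dividing by
  \<open>?\<rho>\<close> itself would lose the strict inequality and fail for
  \<open>?\<rho> = 0\<close>.\<close>

theorem vnorm_normal_le_spectral_radius:
  fixes R :: "real mat"
  assumes R: "R \<in> carrier_mat n n" and n: "0 < n"
    and normal: "transpose_mat R * R = R * transpose_mat R"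
    and v: "v \<in> carrier_vec n"
  shows "vnorm (R *\<^sub>v v) \<le> spectral_radius (map_mat complex_of_real R) * vnorm v"
proof -
  let ?\<rho> = "spectral_radius (map_mat complex_of_real R)"
  have S: "map_mat complex_of_real R \<in> carrier_mat n n" using R by simp
  have nonneg: "0 \<le> ?\<rho>"
    using spectral_radius_mem_max(1)[OF S n] by auto
  have *: "vnorm (R *\<^sub>v v) \<le> r * vnorm v" if r: "?\<rho> < r" for r
  proof -
    have r0: "0 < r" using nonneg r by simp
    let ?Q = "(1 / r) \<cdot>\<^sub>m R"
    have Q: "?Q \<in> carrier_mat n n" using R by simp
    have tr: "transpose_mat ?Q = (1 / r) \<cdot>\<^sub>m transpose_mat R"
      using R by (intro eq_matI) auto
    have T: "transpose_mat R \<in> carrier_mat n n" using R by simp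
    have "transpose_mat ?Q * ?Q = (1 / r) \<cdot>\<^sub>m ((1 / r) \<cdot>\<^sub>m (transpose_mat R * R))"
      unfolding tr using mult_smult_assoc_mat[OF T Q] mult_smult_distrib[OF T R] by simp
    moreover have "?Q * transpose_mat ?Q = (1 / r) \<cdot>\<^sub>m ((1 / r) \<cdot>\<^sub>m (R * transpose_mat R))"
      unfolding tr using mult_smult_assoc_mat[OF R, of "(1 / r) \<cdot>\<^sub>m transpose_mat R" n]
        mult_smult_distrib[OF R T] T by simp
    ultimately have nQ: "transpose_mat ?Q * ?Q = ?Q * transpose_mat ?Q"
      using normal by simp
    have "map_mat complex_of_real ?Q = complex_of_real (1 / r) \<cdot>\<^sub>m map_mat complex_of_real R"
      by (intro eq_matI) auto
    then have "spectral_radius (map_mat complex_of_real ?Q) < 1"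
      using spectral_radius_smult_less_1[OF S n r0 r] by simp
    from normal_contraction[OF Q nQ this v]
    have "vnorm (?Q *\<^sub>v v) \<le> vnorm v" .
    moreover have "?Q *\<^sub>v v = (1 / r) \<cdot>\<^sub>v (R *\<^sub>v v)"
      using R v by (intro eq_vecI) auto
    ultimately show ?thesis
      using r0 by (simp add: vnorm_smult field_simps)
  qed
  show ?thesis
  proof (rule field_le_epsilon)
    fix e :: real assume e: "0 < e"
    show "vnorm (R *\<^sub>v v) \<le> ?\<rho> * vnorm v + e"
    \<comment> \<open>The choice \<open>r = ?\<rho> + e / vnorm v\<close> makes the error exactly
      \<open>e\<close>; for a zero vector any admissible \<open>r\<close> will do.\<close>
    proof (cases "vnorm v = 0")
      case True
      then show ?thesis using *[of "?\<rho> + 1"] e by simp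
    next
      case False
      then have "0 < vnorm v" by (simp add: less_le)
      then show ?thesis using *[of "?\<rho> + e / vnorm v"] e by (simp add: distrib_right)
    qed
  qed
qed

section \<open>Arcs between two colour classes\<close>

definition skew_sign :: "'a pair_pre_digraph \<Rightarrow> 'a \<Rightarrow> 'a \<Rightarrow> real" where
  "skew_sign D u v = (if (u, v) \<in> parcs D then 1 else if (v, u) \<in> parcs D then -1 else 0)"

text \<open>The norm argument runs over the reals; complex entries enter only through the spectral
  radius.\<close>

definition real_skew_mat :: "'a pair_pre_digraph \<Rightarrow> (nat \<Rightarrow> 'a) \<Rightarrow> real mat" where
  "real_skew_mat D \<nu> =
     mat (card (pverts D)) (card (pverts D)) (\<lambda>(i, j). skew_sign D (\<nu> i) (\<nu> j))"

lemma skew_adjacency_mat_eq: "skew_adjacency_mat D \<nu> = map_mat complex_of_real (real_skew_mat D \<nu>)"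
  by (rule eq_matI) (auto simp: skew_adjacency_mat_def real_skew_mat_def skew_sign_def)

text \<open>The transpose is \<open>- ?R\<close>, so both products equal the negated square of
  \<open>?R\<close>.\<close>

lemma real_skew_mat_normal:
  assumes anti: "parcs D \<inter> (parcs D)\<inverse> = {}"
  shows "transpose_mat (real_skew_mat D \<nu>) * real_skew_mat D \<nu>
       = real_skew_mat D \<nu> * transpose_mat (real_skew_mat D \<nu>)"
proof -
  let ?R = "real_skew_mat D \<nu>"
  have R: "?R \<in> carrier_mat (card (pverts D)) (card (pverts D))"
    by (simp add: real_skew_mat_def)
  have neg: "skew_sign D v u = - skew_sign D u v" for u v
    using anti by (auto simp: skew_sign_def)
  have "transpose_mat ?R = - ?R"
    by (intro eq_matI) (auto simp: real_skew_mat_def intro: neg)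
  then show ?thesis using R by simp
qed

text \<open>With no opposite arcs, the sign is a difference of two indicators, and each indicator
  sums to a count. The left side is the bilinear form of the matrix at the indicator vectors of
  \<open>A\<close> and \<open>B\<close>.\<close>

lemma sum_skew_sign:
  assumes anti: "parcs D \<inter> (parcs D)\<inverse> = {}" and fin: "finite A" "finite B"
  shows "(\<Sum>u\<in>A. \<Sum>v\<in>B. skew_sign D u v)
       = real (card (parcs D \<inter> A \<times> B)) - real (card (parcs D \<inter> B \<times> A))"
proof -
  let ?E = "parcs D"
  have "skew_sign D u v = of_bool ((u, v) \<in> ?E) - of_bool ((u, v) \<in> ?E\<inverse>)" for u v
    using anti by (auto simp: skew_sign_def)
  then have "(\<Sum>u\<in>A. \<Sum>v\<in>B. skew_sign D u v)
      = (\<Sum>p\<in>A \<times> B. of_bool (p \<in> ?E) - of_bool (p \<in> ?E\<inverse>))"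
    by (auto simp: sum.cartesian_product intro!: sum.cong)
  also have "\<dots> = real (card (A \<times> B \<inter> ?E)) - real (card (A \<times> B \<inter> ?E\<inverse>))"
    using fin by (simp only: sum_subtractf sum_of_bool_eq finite_cartesian_product Int_def mem_Collect_eq)
  also have "card (A \<times> B \<inter> ?E\<inverse>) = card ((?E \<inter> B \<times> A)\<inverse>)"
    by (rule arg_cong[where f = card]) auto
  finally show ?thesis
    by (simp add: Int_commute)
qed

lemma arcs_between_le:
  assumes fin: "finite (pverts D)" and anti: "parcs D \<inter> (parcs D)\<inverse> = {}"
    and bij: "bij_betw \<nu> {..<card (pverts D)} (pverts D)"
    and A: "A \<subseteq> pverts D" and B: "B \<subseteq> pverts D" and ne: "pverts D \<noteq> {}"
    and dir: "parcs D \<inter> (A \<times> B) = {} \<or> parcs D \<inter> (B \<times> A) = {}"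
  shows "2 * (card (parcs D \<inter> A \<times> B) + card (parcs D \<inter> B \<times> A))
       \<le> skew_spectral_radius D \<nu> * (card A + card B)"
proof -
  let ?n = "card (pverts D)" and ?R = "real_skew_mat D \<nu>" and ?\<rho> = "skew_spectral_radius D \<nu>"
  define ind where "ind X = vec ?n (\<lambda>i. of_bool (\<nu> i \<in> X) :: real)" for X
  have ind: "ind X \<in> carrier_vec ?n" for X by (simp add: ind_def)
  have n: "0 < ?n" using fin ne by (simp add: card_gt_0_iff)
  have R: "?R \<in> carrier_mat ?n ?n" by (simp add: real_skew_mat_def)
  have Rv: "?R *\<^sub>v ind B \<in> carrier_vec ?n" using R ind by simp
  \<comment> \<open>Sums over matrix indices weighted by an indicator become sums over vertices,
    through the enumeration \<open>\<nu>\<close>.\<close>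
  have reindex: "(\<Sum>i<?n. of_bool (\<nu> i \<in> X) * f (\<nu> i)) = (\<Sum>u\<in>X. f u :: real)"
    if "X \<subseteq> pverts D" for X f
    using sum.reindex_bij_betw[OF bij, of "\<lambda>u. of_bool (u \<in> X) * f u"] fin that
    by (simp add: Int_absorb1)
  have norm_ind: "vnorm (ind X) = sqrt (card X)" if "X \<subseteq> pverts D" for X
    using reindex[OF that, of "\<lambda>_. 1"]
    by (simp add: vnorm_def scalar_prod_def ind_def atLeast0LessThan flip: of_bool_conj)
  have entry: "(?R *\<^sub>v ind B) $ i = (\<Sum>v\<in>B. skew_sign D (\<nu> i) v)" if "i < ?n" for i
    using that reindex[OF B, of "skew_sign D (\<nu> i)"]
    by (simp add: real_skew_mat_def ind_def scalar_prod_def atLeast0LessThan mult.commute)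
  have "ind A \<bullet> (?R *\<^sub>v ind B) = (\<Sum>i<?n. of_bool (\<nu> i \<in> A) * (\<Sum>v\<in>B. skew_sign D (\<nu> i) v))"
    using R entry by (simp add: scalar_prod_def atLeast0LessThan ind_def)
  also have "\<dots> = (\<Sum>u\<in>A. \<Sum>v\<in>B. skew_sign D u v)"
    by (rule reindex[OF A])
  also have "\<dots> = real (card (parcs D \<inter> A \<times> B)) - real (card (parcs D \<inter> B \<times> A))"
    using A B fin by (intro sum_skew_sign[OF anti]) (auto intro: finite_subset)
  \<comment> \<open>By \<open>dir\<close> one of the two counts vanishes, so the absolute difference
    equals their sum.\<close>
  finally have form: "\<bar>ind A \<bullet> (?R *\<^sub>v ind B)\<bar>
      = real (card (parcs D \<inter> A \<times> B) + card (parcs D \<inter> B \<times> A))"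
    using dir by auto
  have rho: "0 \<le> ?\<rho>"
    using spectral_radius_mem_max(1)[of "skew_adjacency_mat D \<nu>" ?n] n
    by (auto simp: skew_spectral_radius_def skew_adjacency_mat_def)
  have "\<bar>ind A \<bullet> (?R *\<^sub>v ind B)\<bar> \<le> vnorm (ind A) * vnorm (?R *\<^sub>v ind B)"
    by (rule abs_scalar_prod_le_vnorm[OF ind Rv])
  also have "\<dots> \<le> vnorm (ind A) * (?\<rho> * vnorm (ind B))"
    unfolding skew_spectral_radius_def skew_adjacency_mat_eq
    by (intro mult_left_mono vnorm_normal_le_spectral_radius[OF R n real_skew_mat_normal[OF anti] ind])
      simp
  also have "\<dots> = ?\<rho> * (sqrt (card A) * sqrt (card B))"
    using A B by (simp add: norm_ind)
  \<comment> \<open>The arithmetic-geometric mean inequality makes the bound linear in the class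
    sizes, ready for summation; \<open>rho\<close> preserves its direction.\<close>
  also have "\<dots> \<le> ?\<rho> * ((card A + card B) / 2)"
    using arith_geo_mean_sqrt[of "card A" "card B"] rho
    by (intro mult_left_mono) (simp_all add: real_sqrt_mult)
  finally show ?thesis using form by simp
qed

section \<open>Counting edges and colour classes\<close>

text \<open>Each edge carries exactly one arc: forgetting directions is injective because no two
  arcs are opposite.\<close>

lemma card_edge_set:
  assumes "oriented_graph_of G D"
  shows "card (edge_set G) = card (parcs D)"
proof -
  have G: "parcs G = parcs D \<union> (parcs D)\<inverse>" and anti: "parcs D \<inter> (parcs D)\<inverse> = {}"
    using assms by (auto simp: oriented_graph_of_def)
  have "edge_set G = (\<lambda>(u, v). {u, v}) ` parcs D"
    unfolding edge_set_def G by (force simp: insert_commute)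
  moreover have "inj_on (\<lambda>(u, v). {u, v}) (parcs D)"
    using anti by (auto simp: inj_on_def doubleton_eq_iff)
  ultimately show ?thesis by (simp add: card_image)
qed

text \<open>Between two singletons there is at most one arc, so the partition into singletons
  qualifies. This ensures that the \<open>LEAST\<close> in the chromatic number is attained.\<close>

lemma singleton_coloring:
  assumes "pair_graph G" "oriented_graph_of G D"
  shows "\<exists>k P. oriented_coloring D k P"
proof -
  interpret pair_graph G by fact
  let ?P = "(\<lambda>x. {x}) ` pverts D"
  have "finite (pverts D)" "parcs D \<subseteq> parcs G" "parcs D \<inter> (parcs D)\<inverse> = {}"
    using assms(2) pair_finite_verts by (auto simp: oriented_graph_of_def)
  then have "oriented_coloring D (card ?P) ?P"
    using pair_no_loops unfolding oriented_coloring_def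
    by (auto intro: partition_on_singletons)
  then show ?thesis by blast
qed

text \<open>The ends of an arc lie in different classes. This makes the denominator in the final
  quotient positive.\<close>

lemma oriented_coloring_card_ge_2:
  assumes col: "oriented_coloring D k P" and e: "(u, v) \<in> parcs D"
    and "u \<in> pverts D" "v \<in> pverts D"
  shows "2 \<le> k"
proof -
  have P: "pverts D = \<Union>P" "finite P" "card P = k"
    and indep: "\<And>C. C \<in> P \<Longrightarrow> u \<in> C \<Longrightarrow> v \<notin> C"
    using col e by (auto simp: oriented_coloring_def partition_on_def)
  obtain A B where "A \<in> P" "u \<in> A" "B \<in> P" "v \<in> B"
    using assms P by blast
  then have "{A, B} \<subseteq> P" "A \<noteq> B" using indep by auto
  then have "card {A, B} \<le> k" using P card_mono by metis
  then show ?thesis using \<open>A \<noteq> B\<close> by simp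
qed

text \<open>Classes are independent, so every arc runs between two distinct ones, and disjointness
  of the classes determines that ordered pair.\<close>

lemma card_parcs_eq_sum_classes:
  assumes col: "oriented_coloring D k P" and fin: "finite (parcs D)"
    and wf: "parcs D \<subseteq> pverts D \<times> pverts D"
  shows "card (parcs D) = (\<Sum>A\<in>P. \<Sum>B\<in>P - {A}. card (parcs D \<inter> A \<times> B))"
proof -
  have P: "pverts D = \<Union>P" "disjoint P" "finite P"
    and indep: "\<And>C u v. C \<in> P \<Longrightarrow> u \<in> C \<Longrightarrow> v \<in> C \<Longrightarrow> (u, v) \<notin> parcs D"
    using col by (auto simp: oriented_coloring_def partition_on_def)
  let ?I = "SIGMA A:P. P - {A}"
  have "parcs D = (\<Union>(A, B)\<in>?I. parcs D \<inter> A \<times> B)"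
  proof (intro equalityI subsetI)
    fix e assume e: "e \<in> parcs D"
    obtain u v where uv: "e = (u, v)" by (cases e)
    with e wf P obtain A B where "A \<in> P" "u \<in> A" "B \<in> P" "v \<in> B" by blast
    moreover from this have "A \<noteq> B" using indep e uv by blast
    ultimately show "e \<in> (\<Union>(A, B)\<in>?I. parcs D \<inter> A \<times> B)" using e uv by auto
  qed auto
  then have "card (parcs D) = card (\<Union>(A, B)\<in>?I. parcs D \<inter> A \<times> B)" by simp
  also have "\<dots> = (\<Sum>p\<in>?I. card (case p of (A, B) \<Rightarrow> parcs D \<inter> A \<times> B))"
  proof (rule card_UN_disjoint)
    show "\<forall>p\<in>?I. \<forall>q\<in>?I. p \<noteq> q \<longrightarrow>
        (case p of (A, B) \<Rightarrow> parcs D \<inter> A \<times> B) \<inter> (case q of (A, B) \<Rightarrow> parcs D \<inter> A \<times> B) = {}"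
      using disjointD[OF P(2)] by (clarsimp, blast)
  qed (use P(3) fin in auto)
  also have "\<dots> = (\<Sum>A\<in>P. \<Sum>B\<in>P - {A}. card (parcs D \<inter> A \<times> B))"
    using P(3) by (subst sum.Sigma) (auto intro: sum.cong)
  finally show ?thesis .
qed

lemma sum_off_diagonal_swap:
  fixes f :: "'a \<Rightarrow> 'a \<Rightarrow> 'b::comm_monoid_add"
  assumes "finite P"
  shows "(\<Sum>A\<in>P. \<Sum>B\<in>P - {A}. f B A) = (\<Sum>A\<in>P. \<Sum>B\<in>P - {A}. f A B)"
proof -
  \<comment> \<open>Padding the diagonal with 0 makes the inner range independent of
    \<open>A\<close>, so the two sums can be exchanged.\<close>
  have "(\<Sum>A\<in>P. \<Sum>B\<in>P - {A}. f B A) = (\<Sum>A\<in>P. \<Sum>B\<in>P. if B = A then 0 else f B A)"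
    using assms by (intro sum.cong refl sum.mono_neutral_cong_left) auto
  also have "\<dots> = (\<Sum>B\<in>P. \<Sum>A\<in>P. if A = B then 0 else f B A)"
    by (subst sum.swap) (intro sum.cong refl, auto)
  also have "\<dots> = (\<Sum>B\<in>P. \<Sum>A\<in>P - {B}. f B A)"
    using assms by (intro sum.cong refl sum.mono_neutral_cong_right) auto
  finally show ?thesis .
qed

lemma arcs_le_skew_spectral_radius:
  assumes fin: "finite (pverts D)" "finite (parcs D)" and anti: "parcs D \<inter> (parcs D)\<inverse> = {}"
    and wf: "parcs D \<subseteq> pverts D \<times> pverts D"
    and bij: "bij_betw \<nu> {..<card (pverts D)} (pverts D)" and ne: "pverts D \<noteq> {}"
    and col: "oriented_coloring D k P" and k: "1 \<le> k"
  shows "2 * real (card (parcs D)) \<le> skew_spectral_radius D \<nu> * (real k - 1) * card (pverts D)"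
proof -
  let ?\<rho> = "skew_spectral_radius D \<nu>" and ?n = "card (pverts D)"
  let ?e = "\<lambda>A B. real (card (parcs D \<inter> A \<times> B))"
  have P: "pverts D = \<Union>P" "finite P" "card P = k" "disjoint P"
    and dir: "\<And>A B. A \<in> P \<Longrightarrow> B \<in> P \<Longrightarrow> A \<noteq> B \<Longrightarrow>
      parcs D \<inter> (A \<times> B) = {} \<or> parcs D \<inter> (B \<times> A) = {}"
    using col by (auto simp: oriented_coloring_def partition_on_def)
  have "\<forall>A\<in>P. finite A" using P fin by (metis Sup_upper finite_subset)
  then have n: "?n = (\<Sum>A\<in>P. card A)"
    using P card_Union_disjoint[of P] by (simp add: disjoint_def pairwise_def disjnt_def)
  have m: "real (card (parcs D)) = (\<Sum>A\<in>P. \<Sum>B\<in>P - {A}. ?e A B)"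
    using card_parcs_eq_sum_classes[OF col fin(2) wf] by simp
  \<comment> \<open>The summand is constant in \<open>B\<close> and occurs \<open>k - 1\<close>
    times; \<open>1 \<le> k\<close> makes natural and real subtraction agree.\<close>
  have sizes: "(\<Sum>A\<in>P. \<Sum>B\<in>P - {A}. real (card A)) = (real k - 1) * ?n"
    using P(2,3) k by (simp add: n[unfolded P(1)] sum_distrib_left n)
  \<comment> \<open>Over ordered pairs of classes, \<open>?e A B\<close> and \<open>?e B A\<close>
    each sum to the number of arcs; the inner factor 2 gives 4.\<close>
  have "4 * real (card (parcs D)) = (\<Sum>A\<in>P. \<Sum>B\<in>P - {A}. 2 * (?e A B + ?e B A))"
    by (simp add: m sum.distrib sum_off_diagonal_swap[OF P(2), of ?e] flip: sum_distrib_left)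
  also have "\<dots> \<le> (\<Sum>A\<in>P. \<Sum>B\<in>P - {A}. ?\<rho> * (real (card A) + real (card B)))"
  proof (intro sum_mono)
    fix A B assume AB: "A \<in> P" "B \<in> P - {A}"
    then show "2 * (?e A B + ?e B A) \<le> ?\<rho> * (real (card A) + real (card B))"
      using arcs_between_le[OF fin(1) anti bij _ _ ne dir[of A B]] P(1) by fastforce
  qed
  also have "\<dots> = ?\<rho> * (2 * ((real k - 1) * ?n))"
    using sum_off_diagonal_swap[OF P(2), of "\<lambda>A B. real (card A)"] sizes
    by (simp add: sum.distrib flip: sum_distrib_left)
  finally show ?thesis by simp
qed

theorem theorem2p7:
  fixes G D :: "'a pair_pre_digraph" and \<nu> :: "nat \<Rightarrow> 'a"
  assumes "pair_graph G"
    and "edge_set G \<noteq> {}"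
    and "oriented_graph_of G D"
    and "bij_betw \<nu> {..<card (pverts G)} (pverts G)"
  shows "skew_spectral_radius D \<nu> \<ge>
           average_degree G / (real (oriented_chromatic_number D) - 1)"
proof -
  interpret pair_graph G by fact
  let ?k = "oriented_chromatic_number D"
  have V: "pverts D = pverts G" and G: "parcs G = parcs D \<union> (parcs D)\<inverse>"
    and anti: "parcs D \<inter> (parcs D)\<inverse> = {}"
    using assms(3) by (auto simp: oriented_graph_of_def)
  have fin: "finite (pverts D)" "finite (parcs D)"
    using pair_finite_verts pair_finite_arcs V G by auto
  have wf: "parcs D \<subseteq> pverts D \<times> pverts D"
    using arc_fst_in_verts arc_snd_in_verts V G by fastforce
  obtain u v where e: "(u, v) \<in> parcs D"
    using assms(2) G by (auto simp: edge_set_def)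
  then have uv: "u \<in> pverts D" "v \<in> pverts D" using wf by auto
  obtain P where col: "oriented_coloring D ?k P"
    using LeastI_ex[OF singleton_coloring[OF assms(1,3)]]
    unfolding oriented_chromatic_number_def by blast
  have k: "2 \<le> ?k" by (rule oriented_coloring_card_ge_2[OF col e uv])
  have n: "0 < card (pverts G)" using fin uv V by (auto simp: card_gt_0_iff)
  have "2 * real (card (parcs D)) \<le> skew_spectral_radius D \<nu> * (real ?k - 1) * card (pverts D)"
    using assms(4) uv k by (intro arcs_le_skew_spectral_radius[OF fin anti wf _ _ col]) (auto simp: V)
  \<comment> \<open>Both \<open>card (pverts G)\<close> and \<open>real ?k - 1\<close> are positive,
    so dividing by them turns the arc count into the average degree bound.\<close>
  then show ?thesis
    using n k by (simp add: average_degree_def card_edge_set[OF assms(3)] V divide_simps mult_ac)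
qed

end
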